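(* If $(G,|\cdot|)$ is a normed Abelian group with nonbranching optimal transport plans, then the following two classification statements hold: (1) If $G$ is finitely generated, then $G$ is isometrically isomorphic to $\mathbb Z^k\times\mathbb Z_2^l$ with norm $$|(n_1,\dots,n_k,f_1,\dots,f_l)|=\sum_{i=1}^k\mu_i|n_i|+\sum_{j=1}^l\lambda_j|f_j| ,$$ for some $\mu_i,\lambda_j>0$. (2) If $(G,|\cdot|)$ can be endowed with a multiplication by scalars such that it becomes a finite dimensional normed vector space, then $G$ is isometrically isomorphic (as a normed vector space) to $\ell_1^n$ for some $n\ge 1$, where $\ell_1^n$ is the vector space $\mathbb R^n$ with norm $\|x\|=\sum_{i=1}^n|x_i|$.
   Context: A normed Abelian group $(G,|\cdot|)$ is an Abelian group $G$ with a function $|\cdot|:G\to\mathbb R_{\ge 0}$ such that $|g+h|\le |g|+|h|$ and $|-g|=|g|$ for all $g,h\in G$, and $|g|=0$ if and only if $g=0$. An isometric isomorphism of normed Abelian groups is a norm-preserving group isomorphism. $\mathbb Z_2=\mathbb Z/2\mathbb Z$; $|n_i|$ is the usual absolute value of the integer $n_i$, and $|f_j|$ equals $0$ if $f_j=0$ and $1$ if $f_j\neq 0$ in $\mathbb Z_2$. $G$ has optimal transport plans if for all $g_1,\dots,g_n\in G$ with $g_1+\dots+g_n=0$ and every $n$-point metric space $(\{x_1,\dots,x_n\},d)$, the infimum of $\sum_{1\le i<j\le n}|g_{ij}|\,d(x_i,x_j)$ over all families $(g_{ij})_{i,j=1}^n$ in $G$ with $g_{ij}=-g_{ji}$, $g_{ii}=0$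 and $g_i=\sum_{j=1}^n g_{ij}$ is achieved. $G$ has nonbranching optimal transport plans if it has optimal transport plans and for every finite collection $g_1,\dots,g_n\in G$ with $\sum_{i=1}^n g_i=0$ there are $g_{ij}\in G$, $i,j=1,\dots,n$, with $g_{ij}=-g_{ji}$, $g_{ii}=0$, $g_i=\sum_{j=1}^n g_{ij}$ and $|g_i|=\sum_{j=1}^n|g_{ij}|$ for all $i,j=1,\dots,n$.
   Formalization: In (1), G is also assumed complete in the metric |g-h|: Z+Z√2 with the absolute value refutes the claim otherwise, and the conclusion itself implies completeness. In (2), n≥1 is claimed only for nonzero G, as the zero space is R^0. *)

theory Defs
  imports "HOL-Analysis.Analysis" "HOL-Library.Function_Algebras" "HOL-Library.Z2"
    "HOL-Computational_Algebra.Group_Closure"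
begin

locale normed_ab_group =
  fixes nrm :: "'a::ab_group_add \<Rightarrow> real"
  assumes nrm_nonneg: "0 \<le> nrm g"
    and nrm_triangle: "nrm (g + h) \<le> nrm g + nrm h"
    and nrm_minus: "nrm (- g) = nrm g"
    and nrm_eq_0_iff: "nrm g = 0 \<longleftrightarrow> g = 0"

(* Indices 1..n of the paper become 0..n-1; only the values at indices below n are constrained. *)
definition transport_plan :: "nat \<Rightarrow> (nat \<Rightarrow> 'a::ab_group_add) \<Rightarrow> (nat \<Rightarrow> nat \<Rightarrow> 'a) \<Rightarrow> bool"
  where "transport_plan n g \<gamma> \<longleftrightarrow>
    (\<forall>i<n. \<forall>j<n. \<gamma> i j = - \<gamma> j i) \<and>
    (\<forall>i<n. \<gamma> i i = 0) \<and>
    (\<forall>i<n. g i = (\<Sum>j<n. \<gamma> i j))"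

definition transport_cost ::
    "('a \<Rightarrow> real) \<Rightarrow> nat \<Rightarrow> (nat \<Rightarrow> nat \<Rightarrow> real) \<Rightarrow> (nat \<Rightarrow> nat \<Rightarrow> 'a) \<Rightarrow> real"
  where "transport_cost nrm n d \<gamma> = (\<Sum>j<n. \<Sum>i<j. nrm (\<gamma> i j) * d i j)"

(* The points of an n-point metric space are named by their indices, so that
   Metric_space {..<n} d ranges over all n-point metric spaces. *)
definition has_optimal_transport_plans :: "('a::ab_group_add \<Rightarrow> real) \<Rightarrow> bool"
  where "has_optimal_transport_plans nrm \<longleftrightarrow>
    (\<forall>n g d. (\<Sum>i<n. g i) = 0 \<longrightarrow> Metric_space {..<n} d \<longrightarrow>
      (\<exists>\<gamma>. transport_plan n g \<gamma> \<and>
        transport_cost nrm n d \<gamma> = (INF \<gamma>'\<in>{\<gamma>'. transport_plan n g \<gamma>'}. transport_cost nrm n d \<gamma>')))"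

definition has_nonbranching_optimal_transport_plans :: "('a::ab_group_add \<Rightarrow> real) \<Rightarrow> bool"
  where "has_nonbranching_optimal_transport_plans nrm \<longleftrightarrow>
    has_optimal_transport_plans nrm \<and>
    (\<forall>n g. (\<Sum>i<n. g i) = 0 \<longrightarrow>
      (\<exists>\<gamma>. transport_plan n g \<gamma> \<and> (\<forall>i<n. nrm (g i) = (\<Sum>j<n. nrm (\<gamma> i j)))))"

(* Completeness for the metric nrm (g - h).  The first classification needs it: the group
   Z + Z sqrt 2 of reals with the absolute value is finitely generated and has nonbranching
   optimal transport plans, but it has nonzero elements of arbitrarily small norm. *)
definition complete_nrm :: "('a::ab_group_add \<Rightarrow> real) \<Rightarrow> bool"
  where "complete_nrm nrm \<longleftrightarrow> Metric_space.mcomplete UNIV (\<lambda>g h. nrm (g - h))"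

definition finitely_generated_group :: "'a::ab_group_add itself \<Rightarrow> bool"
  where "finitely_generated_group _ \<longleftrightarrow> (\<exists>S::'a set. finite S \<and> group_closure S = UNIV)"

(* Isometric isomorphism onto a subgroup T (a set closed under the group operations). *)
definition isometric_isomorphism ::
    "('a::ab_group_add \<Rightarrow> real) \<Rightarrow> 'b::ab_group_add set \<Rightarrow> ('b \<Rightarrow> real) \<Rightarrow> ('a \<Rightarrow> 'b) \<Rightarrow> bool"
  where "isometric_isomorphism nrm T nrm' \<phi> \<longleftrightarrow>
    bij_betw \<phi> UNIV T \<and>
    (\<forall>g h. \<phi> (g + h) = \<phi> g + \<phi> h) \<and>
    (\<forall>g. nrm' (\<phi> g) = nrm g)"

(* K^n as the n-tuples extended by zero, with the pointwise addition on functions. *)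
definition tuples :: "nat \<Rightarrow> (nat \<Rightarrow> 'a::zero) set"
  where "tuples n = {x. \<forall>i\<ge>n. x i = 0}"

definition weighted_l1_norm ::
    "nat \<Rightarrow> nat \<Rightarrow> (nat \<Rightarrow> real) \<Rightarrow> (nat \<Rightarrow> real) \<Rightarrow> (nat \<Rightarrow> int) \<times> (nat \<Rightarrow> bit) \<Rightarrow> real"
  where "weighted_l1_norm k l \<mu> \<nu> = (\<lambda>(m, f).
    (\<Sum>i<k. \<mu> i * real_of_int \<bar>m i\<bar>) + (\<Sum>j<l. \<nu> j * (if f j = 0 then 0 else 1)))"

definition l1_norm :: "nat \<Rightarrow> (nat \<Rightarrow> real) \<Rightarrow> real"
  where "l1_norm n x = (\<Sum>i<n. \<bar>x i\<bar>)"

definition fin_dim_normed_space ::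
    "(real \<Rightarrow> 'a \<Rightarrow> 'a) \<Rightarrow> ('a::ab_group_add \<Rightarrow> real) \<Rightarrow> bool"
  where "fin_dim_normed_space smul nrm \<longleftrightarrow>
    (\<exists>B. finite_dimensional_vector_space smul B) \<and>
    normed_ab_group nrm \<and>
    (\<forall>c x. nrm (smul c x) = \<bar>c\<bar> * nrm x)"

end

theory Submission
  imports Defs
begin

text \<open>
  Call \<open>x\<close> a part of \<open>g\<close> if \<open>|g| = |x| + |g - x|\<close>. Nonbranching plans have one
  consequence that drives both classifications. Suppose that in a finite family \<open>g\<^sub>1, \<dots>, g\<^sub>n\<close> no
  nonzero \<open>x\<close> is a part of some \<open>g\<^sub>i\<close> while \<open>- x\<close> is a part of another \<open>g\<^sub>j\<close>. Take a nonbranching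
  plan for \<open>g\<^sub>1, \<dots>, g\<^sub>n\<close> and \<open>- (g\<^sub>1 + \<dots> + g\<^sub>n)\<close>. What flows from \<open>i\<close> to \<open>j\<close> is a part of
  \<open>g\<^sub>i\<close>, and its negative is a part of \<open>g\<^sub>j\<close>, so all of it must flow to the added vertex, and the
  norm of the sum is the sum of the norms (\<open>nrm_sum_no_opposite_parts\<close>).

  Both classifications therefore reduces to finding generators with as few parts as possible.

  In the finitely generated case the group is countable, so by Baire's theorem completeness forces
  it to be discrete. Both pieces of a splitting into nonzero parts have a norm that is smaller
  by at least a fixed amount, so every element is a sum of atoms, the nonzero elements whose only parts are zero and
  themselves. Finitely many atoms generate; keep one of each pair \<open>e, - e\<close>. A sum of signed
  copies of these contains no opposite atoms once it is reduced, and then its norm is the sum of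
  the norms. This is the weighted \<open>\<ell>\<^sub>1\<close> norm, where an atom contributes a factor \<open>\<int>\<^sub>2\<close> exactly if it
  is its own negative. Since the weighted norm vanishes only at zero, there are no further
  relations.

  In the normed space case atoms are replaced by extreme vectors, whose parts are multiples of
  them. They span: from a vector that is not extreme one can strip off the largest possible multiple
  of a part, and the remainder lies in a lower-dimensional face of the cone of parts
  (\<open>not_in_span_parts_of_remainder\<close>); stripping twice writes the vector as a combination of two
  vectors from lower-dimensional faces. A basis of extreme vectors has no opposite parts, so the norm
  in the corresponding coordinates is \<open>\<ell>\<^sub>1\<close> after rescaling.
\<close>

section \<open>Geodesic parts\<close>

context normed_ab_group
begin

lemma nrm_zero: "nrm 0 = 0"
  using nrm_eq_0_iff by blast

lemma nrm_diff_commute: "nrm (a - b) = nrm (b - a)"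
  by (metis minus_diff_eq nrm_minus)

lemma nrm_le_part: "nrm g \<le> nrm x + nrm (g - x)"
  using nrm_triangle[of x "g - x"] by simp

lemma nrm_sum_le: "nrm (\<Sum>i\<in>I. f i) \<le> (\<Sum>i\<in>I. nrm (f i))"
proof (induction I rule: infinite_finite_induct)
  case (insert i I)
  then show ?case using nrm_triangle[of "f i" "sum f I"] by simp
qed (simp_all add: nrm_zero)

definition part :: "'a \<Rightarrow> 'a \<Rightarrow> bool"
  where "part x g \<longleftrightarrow> nrm g = nrm x + nrm (g - x)"

lemma part_zero: "part 0 g"
  by (simp add: part_def nrm_zero)

lemma part_trans:
  assumes "part x y" "part y z"
  shows "part x z"
proof -
  have "nrm (z - x) \<le> nrm (z - y) + nrm (y - x)"
    using nrm_triangle[of "z - y" "y - x"] by simp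
  then show ?thesis
    using assms nrm_le_part[of z x] unfolding part_def by linarith
qed

lemma part_of_zero: "part x 0 \<Longrightarrow> x = 0"
  using nrm_nonneg nrm_eq_0_iff
  by (metis add_nonneg_eq_0_iff nrm_zero part_def)

lemma part_of_sum:
  assumes "finite I" "i \<in> I" "nrm (\<Sum>i\<in>I. f i) = (\<Sum>i\<in>I. nrm (f i))"
  shows "part (f i) (\<Sum>i\<in>I. f i)"
proof -
  have "sum f I - f i = sum f (I - {i})"
    using assms by (simp add: sum.remove)
  moreover have "(\<Sum>i\<in>I. nrm (f i)) = nrm (f i) + (\<Sum>i\<in>I - {i}. nrm (f i))"
    using assms by (simp add: sum.remove)
  ultimately show ?thesis
    using assms(3) nrm_sum_le[of f "I - {i}"] nrm_le_part[of "sum f I" "f i"]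
    unfolding part_def by simp
qed

end

section \<open>Isometric embeddings\<close>

text \<open>
  The isomorphisms below are built from coordinates towards the group, where additivity is easy
  and injectivity is a consequence of the formula for the norm.
\<close>

lemma isometry_inj_on:
  fixes \<psi> :: "'b::ab_group_add \<Rightarrow> 'a::ab_group_add"
  assumes "normed_ab_group nrm"
    and diff: "\<And>x y. x \<in> T \<Longrightarrow> y \<in> T \<Longrightarrow> x - y \<in> T"
    and add: "\<And>x y. x \<in> T \<Longrightarrow> y \<in> T \<Longrightarrow> \<psi> (x + y) = \<psi> x + \<psi> y"
    and norm: "\<And>x. x \<in> T \<Longrightarrow> nrm (\<psi> x) = nrm' x"
    and definite: "\<And>x. x \<in> T \<Longrightarrow> nrm' x = 0 \<Longrightarrow> x = 0"
  shows "inj_on \<psi> T"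
proof
  fix x y assume xy: "x \<in> T" "y \<in> T" "\<psi> x = \<psi> y"
  interpret normed_ab_group nrm by fact
  have "\<psi> x = \<psi> (x - y) + \<psi> y"
    using add[OF diff[OF xy(1,2)] xy(2)] by simp
  then have "\<psi> (x - y) = 0" using xy(3) by (metis add_cancel_left_left)
  then have "x - y = 0"
    using norm[of "x - y"] definite[of "x - y"] diff[OF xy(1,2)] nrm_zero by simp
  then show "x = y" by simp
qed

lemma isometric_isomorphism_inv_into:
  fixes \<psi> :: "'b::ab_group_add \<Rightarrow> 'a::ab_group_add"
  assumes bij: "bij_betw \<psi> T UNIV"
    and plus: "\<And>x y. x \<in> T \<Longrightarrow> y \<in> T \<Longrightarrow> x + y \<in> T"
    and add: "\<And>x y. x \<in> T \<Longrightarrow> y \<in> T \<Longrightarrow> \<psi> (x + y) = \<psi> x + \<psi> y"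
    and norm: "\<And>x. x \<in> T \<Longrightarrow> nrm (\<psi> x) = nrm' x"
  shows "isometric_isomorphism nrm T nrm' (inv_into T \<psi>)"
proof -
  let ?\<phi> = "inv_into T \<psi>"
  have mem: "?\<phi> g \<in> T" and inv: "\<psi> (?\<phi> g) = g" for g
    using bij by (auto simp: bij_betw_def intro: inv_into_into f_inv_into_f)
  have "?\<phi> (g + h) = ?\<phi> g + ?\<phi> h" for g h
  proof -
    have "\<psi> (?\<phi> g + ?\<phi> h) = g + h" by (simp add: add mem inv)
    then show ?thesis
      by (metis bij bij_betw_imp_inj_on inv_into_f_f mem plus)
  qed
  then show ?thesis
    unfolding isometric_isomorphism_def
    using bij_betw_inv_into[OF bij] norm mem inv by metis
qed

section \<open>Families without opposite parts\<close>

locale nonbranching_group = normed_ab_group nrm for nrm :: "'a::ab_group_add \<Rightarrow> real" +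
  assumes nonbranching: "(\<Sum>i<n. g i) = 0 \<Longrightarrow>
    \<exists>\<gamma>. transport_plan n g \<gamma> \<and> (\<forall>i<n. nrm (g i) = (\<Sum>j<n. nrm (\<gamma> i j)))"
begin

text \<open>
  In a nonbranching plan every entry is a part of its row sum. If the family has no opposite
  parts, skew symmetry leaves only the entries in the row and the column of the added vertex.
\<close>

lemma nrm_sum_no_opposite_parts_lessThan:
  fixes g :: "nat \<Rightarrow> 'a"
  assumes "\<And>i j x. i < n \<Longrightarrow> j < n \<Longrightarrow> i \<noteq> j \<Longrightarrow> part x (g i) \<Longrightarrow> part (- x) (g j) \<Longrightarrow> x = 0"
  shows "nrm (\<Sum>i<n. g i) = (\<Sum>i<n. nrm (g i))"
proof -
  \<comment> \<open>The extra index \<open>n\<close> absorbs the sum, so that the total becomes zero.\<close>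
  define h where "h i = (if i < n then g i else - (\<Sum>i<n. g i))" for i
  have "(\<Sum>i<Suc n. h i) = 0" by (simp add: h_def)
  from nonbranching[OF this] obtain \<gamma> where
    plan: "transport_plan (Suc n) h \<gamma>"
    and norm: "\<And>i. i < Suc n \<Longrightarrow> nrm (h i) = (\<Sum>j<Suc n. nrm (\<gamma> i j))"
    by blast
  have skew: "\<gamma> i j = - \<gamma> j i" and diag: "\<gamma> i i = 0" and row: "h i = (\<Sum>j<Suc n. \<gamma> i j)"
    if "i < Suc n" "j < Suc n" for i j
    using plan that unfolding transport_plan_def by blast+
  have part: "part (\<gamma> i j) (h i)" if "i < Suc n" "j < Suc n" for i j
    using part_of_sum[of "{..<Suc n}" j "\<gamma> i"] norm[OF that(1)] row[OF that] that by simp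
  have zero: "\<gamma> i j = 0" if "i < n" "j < n" for i j
  proof (cases "i = j")
    case False
    moreover have "part (\<gamma> i j) (g i)" "part (- \<gamma> i j) (g j)"
      using part[of i j] part[of j i] skew[of j i] that by (simp_all add: h_def)
    ultimately show ?thesis using assms that by blast
  qed (use diag[of i i] that in simp)
  have last: "\<gamma> i n = g i" if "i < n" for i
    using row[of i n] zero that by (simp add: h_def)
  have "nrm (\<Sum>i<n. g i) = nrm (h n)"
    by (simp add: h_def nrm_minus)
  also have "\<dots> = (\<Sum>j<n. nrm (\<gamma> n j))"
    using norm[of n] diag[of n n] by (simp add: nrm_zero)
  also have "\<dots> = (\<Sum>j<n. nrm (g j))"
  proof (rule sum.cong)
    fix j assume "j \<in> {..<n}"
    then show "nrm (\<gamma> n j) = nrm (g j)"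
      using skew[of n j] last[of j] by (simp add: nrm_minus)
  qed simp
  finally show ?thesis .
qed

lemma nrm_sum_no_opposite_parts:
  fixes g :: "'i \<Rightarrow> 'a"
  assumes "finite I"
    and "\<And>i j x. i \<in> I \<Longrightarrow> j \<in> I \<Longrightarrow> i \<noteq> j \<Longrightarrow> part x (g i) \<Longrightarrow> part (- x) (g j) \<Longrightarrow> x = 0"
  shows "nrm (\<Sum>i\<in>I. g i) = (\<Sum>i\<in>I. nrm (g i))"
proof -
  obtain b where b: "bij_betw b {..<card I} I"
    using ex_bij_betw_nat_finite[OF assms(1)] by (auto simp: atLeast0LessThan)
  have "nrm (\<Sum>i<card I. g (b i)) = (\<Sum>i<card I. nrm (g (b i)))"
  proof (rule nrm_sum_no_opposite_parts_lessThan)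
    fix i j x
    assume *: "i < card I" "j < card I" "i \<noteq> j" "part x (g (b i))" "part (- x) (g (b j))"
    then have "b i \<in> I" "b j \<in> I" "b i \<noteq> b j"
      using b by (auto simp: bij_betw_def inj_on_def)
    with * show "x = 0" using assms(2) by blast
  qed
  then show ?thesis
    using sum.reindex_bij_betw[OF b, of g] sum.reindex_bij_betw[OF b, of "\<lambda>i. nrm (g i)"] by simp
qed

end

section \<open>Finitely generated groups\<close>

lemma group_closure_mono: "A \<subseteq> B \<Longrightarrow> group_closure A \<subseteq> group_closure B"
proof
  fix x assume "A \<subseteq> B" "x \<in> group_closure A"
  from this(2) show "x \<in> group_closure B"
    by induction (use \<open>A \<subseteq> B\<close> in \<open>auto intro: group_closure.intros\<close>)
qed

lemma group_closure_minimal: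
  assumes "A \<subseteq> H" "0 \<in> H" "\<And>x y. x \<in> H \<Longrightarrow> y \<in> H \<Longrightarrow> x - y \<in> H"
  shows "group_closure A \<subseteq> H"
proof
  fix x assume "x \<in> group_closure A"
  then show "x \<in> H" by induction (use assms in auto)
qed

lemma countable_group_closure:
  fixes S :: "'a::ab_group_add set"
  assumes "finite S"
  shows "countable (group_closure S)"
proof -
  let ?H = "sum_list ` lists (S \<union> uminus ` S)"
  have "group_closure S \<subseteq> ?H"
  proof (rule group_closure_minimal)
    show "S \<subseteq> ?H"
    proof
      fix s assume "s \<in> S"
      then have "[s] \<in> lists (S \<union> uminus ` S)" by simp
      then show "s \<in> ?H" by (rule rev_image_eqI) simp
    qed
    show "0 \<in> ?H" by (rule image_eqI[of _ _ "[]"]) auto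
  next
    fix x y assume "x \<in> ?H" "y \<in> ?H"
    then obtain xs ys where *: "xs \<in> lists (S \<union> uminus ` S)" "ys \<in> lists (S \<union> uminus ` S)"
      "x = sum_list xs" "y = sum_list ys" by blast
    have "sum_list (map uminus zs) = - sum_list zs" for zs :: "'a list"
      by (induction zs) simp_all
    then have "x - y = sum_list (xs @ map uminus ys)" using * by simp
    moreover have "- z \<in> S \<union> uminus ` S" if "z \<in> S \<union> uminus ` S" for z
      using that by auto
    then have "xs @ map uminus ys \<in> lists (S \<union> uminus ` S)"
      using *(1,2) by (simp add: in_lists_conv_set ball_Un)
    ultimately show "x - y \<in> ?H" by blast
  qed
  moreover have "countable ?H"
    using assms by (intro countable_image countable_lists) (simp add: countable_finite)
  ultimately show ?thesis by (rule countable_subset)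
qed

context normed_ab_group
begin

lemma metric_space: "Metric_space UNIV (\<lambda>g h. nrm (g - h))"
proof
  show "nrm (x - z) \<le> nrm (x - y) + nrm (y - z)" for x y z
    using nrm_triangle[of "x - y" "y - z"] by simp
qed (simp_all add: nrm_nonneg nrm_eq_0_iff nrm_diff_commute)

text \<open>
  Without a lower bound on the nonzero norms no point is isolated, so all complements of points are
  open and dense. There are countably many of them and their intersection is empty, against
  Baire's theorem.
\<close>

lemma countable_complete_imp_discrete:
  assumes "countable (UNIV :: 'a set)" "complete_nrm nrm"
  obtains \<epsilon> where "\<epsilon> > 0" "\<And>g. g \<noteq> 0 \<Longrightarrow> \<epsilon> \<le> nrm g"
proof (rule ccontr)
  assume "\<not> thesis"
  then have small: "\<exists>g. g \<noteq> 0 \<and> nrm g < \<epsilon>" if "\<epsilon> > 0" for \<epsilon>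
    using that \<open>\<And>\<epsilon>. \<epsilon> > 0 \<Longrightarrow> (\<And>g. g \<noteq> 0 \<Longrightarrow> \<epsilon> \<le> nrm g) \<Longrightarrow> thesis\<close> by force
  interpret M: Metric_space UNIV "\<lambda>g h. nrm (g - h)" by (rule metric_space)
  have "M.mtopology closure_of (\<Inter> (range (\<lambda>g::'a. - {g}))) = UNIV"
  proof (rule M.metric_Baire_category)
    show "M.mcomplete" using assms(2) by (simp add: complete_nrm_def)
    show "countable (range (\<lambda>g::'a. - {g}))" using assms(1) by simp
    fix U :: "'a set" assume "U \<in> range (\<lambda>g. - {g})"
    then obtain g where U: "U = - {g}" by blast
    have "openin M.mtopology U"
      using closedin_Hausdorff_sing_eq[OF M.Hausdorff_space_mtopology, of g]
      by (simp add: U closedin_def Compl_eq_Diff_UNIV)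
    moreover have "M.mtopology closure_of U = UNIV"
    proof -
      have "x \<in> M.mtopology closure_of U" for x
        unfolding M.metric_closure_of
      proof (simp add: M.in_mball, intro allI impI)
        fix r :: real assume "r > 0"
        then obtain h where h: "h \<noteq> 0" "nrm h < r" using small by blast
        have "\<exists>y\<in>U. nrm (x - y) < r"
        proof (cases "x = g")
          case True
          then have "x + h \<in> U" "nrm (x - (x + h)) < r"
            using h by (auto simp: U nrm_minus)
          then show ?thesis by blast
        next
          case False
          then show ?thesis using \<open>r > 0\<close> by (intro bexI[of _ x]) (auto simp: U nrm_zero)
        qed
        then show "\<exists>y\<in>U. nrm (x - y) < r" .
      qed
      then show ?thesis by blast
    qed
    ultimately show "openin M.mtopology U \<and> M.mtopology closure_of U = UNIV" ..
  qed
  moreover have "\<Inter> (range (\<lambda>g::'a. - {g})) = {}" by auto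
  ultimately show False by simp
qed

definition atom :: "'a \<Rightarrow> bool"
  where "atom e \<longleftrightarrow> e \<noteq> 0 \<and> (\<forall>x. part x e \<longrightarrow> x = 0 \<or> x = e)"

lemma part_minus: "part x g \<Longrightarrow> part (- x) (- g)"
  using nrm_diff_commute[of g x] by (simp add: part_def nrm_minus)

lemma atom_minus:
  assumes "atom e"
  shows "atom (- e)"
  unfolding atom_def
proof (intro conjI allI impI)
  fix x assume "part x (- e)"
  then have "part (- x) e" using part_minus[of x "- e"] by simp
  then have "- x = 0 \<or> - x = e" using assms unfolding atom_def by blast
  then show "x = 0 \<or> x = - e" by auto
qed (use assms in \<open>simp add: atom_def\<close>)

text \<open>
  Proper parts of \<open>g\<close> have norm at most \<open>|g| - \<epsilon>\<close>, so splitting into parts must end, and it ends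
  in atoms.
\<close>

lemma atoms_generate:
  assumes "\<epsilon> > 0" "\<And>g. g \<noteq> 0 \<Longrightarrow> \<epsilon> \<le> nrm g"
  shows "\<exists>A. finite A \<and> (\<forall>e\<in>A. atom e) \<and> g \<in> group_closure A"
proof -
  have "\<exists>A. finite A \<and> (\<forall>e\<in>A. atom e) \<and> g \<in> group_closure A" if "nrm g < real n * \<epsilon>" for n g
    using that
  proof (induction n arbitrary: g)
    case 0
    then show ?case using nrm_nonneg[of g] by simp
  next
    case (Suc n)
    show ?case
    proof (cases "g = 0 \<or> atom g")
      case True
      then show ?thesis
      proof
        assume "g = 0"
        then show ?thesis by (intro exI[of _ "{}"]) simp
      next
        assume "atom g"
        then show ?thesis by (intro exI[of _ "{g}"]) (auto intro: group_closure.base)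
      qed
    next
      case False
      then obtain x where x: "part x g" "x \<noteq> 0" "x \<noteq> g"
        unfolding atom_def by blast
      then have "\<epsilon> \<le> nrm x" "\<epsilon> \<le> nrm (g - x)" using assms(2) by auto
      then have "nrm x < real n * \<epsilon>" "nrm (g - x) < real n * \<epsilon>"
        using x(1) Suc.prems by (auto simp: part_def algebra_simps)
      then obtain A B where *: "finite A" "\<forall>e\<in>A. atom e" "x \<in> group_closure A"
        "finite B" "\<forall>e\<in>B. atom e" "g - x \<in> group_closure B"
        using Suc.IH by metis
      then have "x + (g - x) \<in> group_closure (A \<union> B)"
        using group_closure_mono[of A "A \<union> B"] group_closure_mono[of B "A \<union> B"]
        by (intro group_closure_add) auto
      then show ?thesis using * by (intro exI[of _ "A \<union> B"]) auto
    qed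
  qed
  moreover obtain n where "nrm g < real n * \<epsilon>"
    using reals_Archimedean3[OF assms(1)] by blast
  ultimately show ?thesis by blast
qed

end

lemma representatives_up_to_sign:
  fixes A :: "'a::ab_group_add set"
  assumes "finite A"
  shows "\<exists>P\<subseteq>A. (\<forall>a\<in>A. a \<in> P \<or> - a \<in> P) \<and> (\<forall>p\<in>P. - p \<in> P \<longrightarrow> - p = p)"
  using assms
proof induction
  case (insert a A)
  then obtain P where P: "P \<subseteq> A" "\<forall>a\<in>A. a \<in> P \<or> - a \<in> P" "\<forall>p\<in>P. - p \<in> P \<longrightarrow> - p = p"
    by blast
  show ?case
  proof (cases "- a \<in> P")
    case True
    then show ?thesis using P by (intro exI[of _ P]) auto
  next
    case False
    have "- p = p" if "p \<in> insert a P" "- p \<in> insert a P" for p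
    proof (cases "p = a \<or> - p = a")
      case True
      then have "- p = p \<or> - a \<in> P" using that by auto
      then show ?thesis using False by blast
    next
      case not_a: False
      then show ?thesis using that P(3) by blast
    qed
    then have "\<forall>p\<in>insert a P. - p \<in> insert a P \<longrightarrow> - p = p" by blast
    moreover have "insert a P \<subseteq> insert a A" "\<forall>b\<in>insert a A. b \<in> insert a P \<or> - b \<in> insert a P"
      using P(1,2) by blast+
    ultimately show ?thesis by blast
  qed
qed simp

text \<open>
  The \<open>\<int>\<close>-module structure of an abelian group. Written with constant sums, a multiple of an atom
  is visibly a sum of a family of atoms.
\<close>

definition zscale :: "int \<Rightarrow> 'a::ab_group_add \<Rightarrow> 'a"
  where "zscale m g = (\<Sum>i<nat m. g) - (\<Sum>i<nat (- m). g)"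

lemma sum_const_lessThan_add: "(\<Sum>i<a + b. g) = (\<Sum>i<a. g) + (\<Sum>i<(b::nat). g :: 'a::ab_group_add)"
  by (induction b) (simp_all add: algebra_simps)

lemma zscale_of_nat_diff: "zscale (int a - int b) g = (\<Sum>i<a. g) - (\<Sum>i<b. g)"
proof (cases "b \<le> a")
  case True
  then obtain c where "a = b + c" using le_Suc_ex by blast
  then show ?thesis by (simp add: zscale_def sum_const_lessThan_add)
next
  case False
  then obtain c where "b = a + c" using le_Suc_ex nat_le_linear by blast
  then show ?thesis by (simp add: zscale_def sum_const_lessThan_add)
qed

lemma zscale_add: "zscale (m + n) g = zscale m g + zscale n g"
proof -
  obtain a b c d where m: "m = int a - int b" and n: "n = int c - int d"
    by (metis int_diff_cases)
  have "m + n = int (a + c) - int (b + d)" by (simp add: m n)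
  then have "zscale (m + n) g = (\<Sum>i<a + c. g) - (\<Sum>i<b + d. g)"
    by (metis zscale_of_nat_diff)
  then show ?thesis
    unfolding m n zscale_of_nat_diff sum_const_lessThan_add by (simp add: algebra_simps)
qed

lemma zscale_eq_sum: "zscale m g = (\<Sum>i<nat \<bar>m\<bar>. if 0 \<le> m then g else - g)"
  by (cases "0 \<le> m") (simp_all add: zscale_def sum_negf)

lemma zscale_0 [simp]: "zscale 0 g = 0" and zscale_1 [simp]: "zscale 1 g = g"
  by (simp_all add: zscale_def)

context nonbranching_group
begin

text \<open>
  Expanding the multiples writes the combination as a sum of atoms in which each \<open>p i\<close> occurs with
  one sign only and each \<open>q j\<close> at most once. No two terms are opposite, hence the terms have no
  opposite parts.
\<close>

lemma nrm_zscale_combination: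
  fixes m :: "nat \<Rightarrow> int" and f :: "nat \<Rightarrow> bit"
  assumes p: "\<And>i. i < k \<Longrightarrow> atom (p i)" and q: "\<And>j. j < l \<Longrightarrow> atom (q j)"
    and p_inj: "\<And>i i'. i < k \<Longrightarrow> i' < k \<Longrightarrow> p i = p i' \<or> p i = - p i' \<Longrightarrow> i = i' \<and> p i \<noteq> - p i'"
    and q_inj: "\<And>j j'. j < l \<Longrightarrow> j' < l \<Longrightarrow> q j = q j' \<Longrightarrow> j = j'"
    and q_minus: "\<And>j. j < l \<Longrightarrow> - q j = q j"
    and pq: "\<And>i j. i < k \<Longrightarrow> j < l \<Longrightarrow> p i \<noteq> q j"
  shows "nrm ((\<Sum>i<k. zscale (m i) (p i)) + (\<Sum>j<l. if f j = 0 then 0 else q j)) =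
    weighted_l1_norm k l (\<lambda>i. nrm (p i)) (\<lambda>j. nrm (q j)) (m, f)"
proof -
  \<comment> \<open>One index for each term: \<open>|m i|\<close> copies of \<open>p i\<close> up to sign, and \<open>q j\<close> where \<open>f j\<close> is nonzero.\<close>
  define I where "I = (SIGMA i:{..<k}. {..<nat \<bar>m i\<bar>}) <+> {j. j < l \<and> f j \<noteq> 0}"
  define e where "e = case_sum (\<lambda>(i, s::nat). if 0 \<le> m i then p i else - p i) q"
  have neq: "q j \<noteq> p i" "q j \<noteq> - p i" if "i < k" "j < l" for i j
  proof -
    show "q j \<noteq> p i" using pq[OF that] by simp
    show "q j \<noteq> - p i"
    proof
      assume "q j = - p i"
      then have "- q j = p i" by simp
      then show False using pq[OF that] q_minus[OF that(2)] by simp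
    qed
  qed
  have "finite I" by (simp add: I_def)
  have sum_I: "sum h I = (\<Sum>i<k. \<Sum>s<nat \<bar>m i\<bar>. h (Inl (i, s))) + (\<Sum>j<l. if f j = 0 then 0 else h (Inr j))"
    for h :: "_ \<Rightarrow> 'c::comm_monoid_add"
  proof -
    have "(\<Sum>j | j < l \<and> f j \<noteq> 0. h (Inr j)) = (\<Sum>j<l. if f j = 0 then 0 else h (Inr j))"
      by (rule sum.mono_neutral_cong_left) auto
    then show ?thesis
      unfolding I_def by (subst sum.Plus) (simp_all add: sum.Sigma split_def)
  qed
  have "nrm (sum e I) = (\<Sum>i\<in>I. nrm (e i))"
  proof (rule nrm_sum_no_opposite_parts[OF \<open>finite I\<close>])
    fix a b x assume ab: "a \<in> I" "b \<in> I" "a \<noteq> b" and x: "part x (e a)" "part (- x) (e b)"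
    have "atom (e a)" if "a \<in> I" for a
      using that p q by (auto simp: I_def e_def atom_minus split: if_splits)
    with ab x have "x = 0 \<or> x = e a" "- x = 0 \<or> - x = e b"
      unfolding atom_def by blast+
    moreover have "e b \<noteq> - e a"
    proof
      assume opp: "e b = - e a"
      show False
      proof (cases a; cases b)
        fix u v assume uv: "a = Inl u" "b = Inl v"
        obtain i s i' s' where uv_eq: "u = (i, s)" "v = (i', s')" by fastforce
        have lt: "i < k" "i' < k" using ab uv uv_eq by (auto simp: I_def)
        have "p i' = p i \<or> p i' = - p i"
          using opp unfolding uv uv_eq e_def by (auto split: if_splits)
        then have "i' = i" "p i' \<noteq> - p i" using p_inj[OF lt(2,1)] by auto
        then show False
          using opp unfolding uv uv_eq e_def by (auto split: if_splits)
      next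
        fix u j assume uj: "a = Inl u" "b = Inr j"
        obtain i s where uv_eq: "u = (i, s)" by fastforce
        have "i < k" "j < l" using ab uj uv_eq by (auto simp: I_def)
        then show False
          using opp neq[of i j] unfolding uj uv_eq e_def by (auto split: if_splits)
      next
        fix j u assume uj: "a = Inr j" "b = Inl u"
        obtain i s where uv_eq: "u = (i, s)" by fastforce
        have "i < k" "j < l" using ab uj uv_eq by (auto simp: I_def)
        then have "q j \<noteq> p i" "q j \<noteq> - p i" "- q j = q j"
          using neq q_minus by blast+
        then show False
          using opp unfolding uj uv_eq e_def sum.case prod.case by (metis (full_types))
      next
        fix j j' assume jj: "a = Inr j" "b = Inr j'"
        have "j < l" "j' < l" using ab jj by (auto simp: I_def)
        moreover from this have "q j = q j'"
          using opp q_minus[of j] unfolding jj e_def sum.case by (simp only:)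
        ultimately show False
          using q_inj[of j j'] ab(3) jj by simp
      qed
    qed
    ultimately show "x = 0" by auto
  qed
  moreover have "sum e I = (\<Sum>i<k. zscale (m i) (p i)) + (\<Sum>j<l. if f j = 0 then 0 else q j)"
    by (simp add: sum_I e_def zscale_eq_sum cong: if_cong)
  moreover have "(\<Sum>i\<in>I. nrm (e i)) = weighted_l1_norm k l (\<lambda>i. nrm (p i)) (\<lambda>j. nrm (q j)) (m, f)"
  proof -
    have "(\<Sum>s<nat \<bar>m i\<bar>. nrm (e (Inl (i, s)))) = nrm (p i) * real_of_int \<bar>m i\<bar>" for i
      by (simp add: e_def nrm_minus)
    moreover have "(\<Sum>j<l. if f j = 0 then 0 else nrm (e (Inr j))) =
      (\<Sum>j<l. nrm (q j) * (if f j = 0 then 0 else 1))"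
      by (rule sum.cong) (simp_all add: e_def)
    ultimately show ?thesis
      unfolding sum_I weighted_l1_norm_def by simp
  qed
  ultimately show ?thesis by simp
qed

theorem finitely_generated_classification:
  assumes "finitely_generated_group TYPE('a)" "complete_nrm nrm"
  shows "\<exists>k l \<mu> \<nu> \<phi>. (\<forall>i<k. \<mu> i > 0) \<and> (\<forall>j<l. \<nu> j > 0) \<and>
    isometric_isomorphism nrm (tuples k \<times> tuples l) (weighted_l1_norm k l \<mu> \<nu>) \<phi>"
proof -
  obtain S :: "'a set" where S: "finite S" "group_closure S = UNIV"
    using assms(1) unfolding finitely_generated_group_def by blast
  obtain \<epsilon> where \<epsilon>: "\<epsilon> > 0" "\<And>g. g \<noteq> 0 \<Longrightarrow> \<epsilon> \<le> nrm g"
    using countable_complete_imp_discrete[OF _ assms(2)] countable_group_closure[OF S(1)] S(2)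
    by metis
  obtain D where D: "\<And>g. finite (D g) \<and> (\<forall>e\<in>D g. atom e) \<and> g \<in> group_closure (D g)"
    using atoms_generate[OF \<epsilon>] by metis
  define A where "A = (\<Union>s\<in>S. D s)"
  have A: "finite A" "\<And>e. e \<in> A \<Longrightarrow> atom e" using D S by (auto simp: A_def)
  have "S \<subseteq> group_closure A"
  proof
    fix s assume "s \<in> S"
    then have "D s \<subseteq> A" by (auto simp: A_def)
    then show "s \<in> group_closure A" using D[of s] group_closure_mono by blast
  qed
  then have A_gen: "group_closure A = UNIV"
    using group_closure_minimal[of S "group_closure A"] S(2) by (auto intro: group_closure.diff)
  obtain P where P: "P \<subseteq> A" "\<And>a. a \<in> A \<Longrightarrow> a \<in> P \<or> - a \<in> P" "\<And>p. p \<in> P \<Longrightarrow> - p \<in> P \<Longrightarrow> - p = p"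
    using representatives_up_to_sign[OF A(1)] by blast
  \<comment> \<open>Atoms of infinite order yield the factors \<open>\<int>\<close>, those that are their own negative the factors \<open>\<int>\<^sub>2\<close>.\<close>
  define P1 where "P1 = {p \<in> P. - p \<noteq> p}"
  define P2 where "P2 = {p \<in> P. - p = p}"
  define k where "k = card P1"
  define l where "l = card P2"
  have "finite P" using P(1) A(1) by (rule finite_subset)
  then obtain p q where p: "bij_betw p {..<k} P1" and q: "bij_betw q {..<l} P2"
    using ex_bij_betw_nat_finite[of P1] ex_bij_betw_nat_finite[of P2]
    by (auto simp: k_def l_def P1_def P2_def atLeast0LessThan)
  have p_mem: "p i \<in> P1" if "i < k" for i using p that by (auto simp: bij_betw_def)
  have q_mem: "q j \<in> P2" if "j < l" for j using q that by (auto simp: bij_betw_def)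
  define T where "T = (tuples k \<times> tuples l :: ((nat \<Rightarrow> int) \<times> (nat \<Rightarrow> bit)) set)"
  define \<psi> where "\<psi> = (\<lambda>(m, f). (\<Sum>i<k. zscale (m i) (p i)) + (\<Sum>j<l. if f j = (0::bit) then 0 else q j))"
  define nrm' where "nrm' = weighted_l1_norm k l (\<lambda>i. nrm (p i)) (\<lambda>j. nrm (q j))"
  have q_minus: "- q j = q j" if "j < l" for j using q_mem[OF that] by (simp add: P2_def)
  have norm: "nrm (\<psi> x) = nrm' x" for x
  proof -
    have "nrm (\<psi> (m, f)) = nrm' (m, f)" for m f
      unfolding \<psi>_def nrm'_def prod.case
    proof (rule nrm_zscale_combination)
      show "atom (p i)" if "i < k" for i using p_mem[OF that] A P by (auto simp: P1_def)
      show "atom (q j)" if "j < l" for j using q_mem[OF that] A P by (auto simp: P2_def)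
      show "- q j = q j" if "j < l" for j using q_minus[OF that] .
      show "p i \<noteq> q j" if "i < k" "j < l" for i j
        using p_mem[OF that(1)] q_mem[OF that(2)] by (auto simp: P1_def P2_def)
      show "j = j'" if "j < l" "j' < l" "q j = q j'" for j j'
        using q that by (auto simp: bij_betw_def inj_on_def)
      show "i = i' \<and> p i \<noteq> - p i'" if "i < k" "i' < k" "p i = p i' \<or> p i = - p i'" for i i'
      proof -
        have "p i \<in> P" "p i' \<in> P" "- p i' \<noteq> p i'"
          using p_mem[OF that(1)] p_mem[OF that(2)] by (auto simp: P1_def)
        then have "p i \<noteq> - p i'" using P(3) by metis
        then show ?thesis using that p by (auto simp: bij_betw_def inj_on_def)
      qed
    qed
    then show ?thesis by (cases x) simp
  qed
  have \<psi>_add: "\<psi> (x + y) = \<psi> x + \<psi> y" for x y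
  proof -
    have "(if f + f' = 0 then 0 else q j) = (if f = 0 then 0 else q j) + (if f' = 0 then 0 else q j)"
      if "j < l" for j and f f' :: bit
    proof -
      have "q j + q j = 0" using q_minus[OF that] by (metis add.right_inverse)
      then show ?thesis by (cases f; cases f') simp_all
    qed
    then show ?thesis
      by (cases x; cases y) (simp add: \<psi>_def zscale_add sum.distrib algebra_simps)
  qed
  have T_diff: "x - y \<in> T" and T_add: "x + y \<in> T" if "x \<in> T" "y \<in> T" for x y
    using that by (auto simp: T_def tuples_def)
  have pos_p: "nrm (p i) > 0" if "i < k" for i
    using p_mem[OF that] nrm_nonneg[of "p i"] nrm_eq_0_iff[of "p i"] by (auto simp: P1_def less_le)
  have pos_q: "nrm (q j) > 0" if "j < l" for j
    using q_mem[OF that] A P nrm_nonneg[of "q j"] nrm_eq_0_iff[of "q j"]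
    by (auto simp: P2_def less_le atom_def)
  have definite: "x = 0" if "x \<in> T" "nrm' x = 0" for x
  proof -
    obtain m f where x: "x = (m, f)" by fastforce
    define u where "u i = nrm (p i) * real_of_int \<bar>m i\<bar>" for i
    define v where "v j = nrm (q j) * (if f j = 0 then 0 else 1)" for j
    have nonneg: "0 \<le> u i" "0 \<le> v i" for i
      by (simp_all add: u_def v_def nrm_nonneg)
    have "sum u {..<k} + sum v {..<l} = 0"
      using that(2) unfolding nrm'_def x weighted_l1_norm_def u_def v_def by simp
    moreover have "0 \<le> sum u {..<k}" "0 \<le> sum v {..<l}"
      using nonneg by (simp_all add: sum_nonneg)
    ultimately have "sum u {..<k} = 0" "sum v {..<l} = 0" by linarith+
    have "u i = 0" if "i < k" for i
      using \<open>sum u {..<k} = 0\<close> nonneg that by (simp add: sum_nonneg_eq_0_iff)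
    then have m: "m i = 0" if "i < k" for i
      using that pos_p[OF that] by (force simp: u_def)
    have "v j = 0" if "j < l" for j
      using \<open>sum v {..<l} = 0\<close> nonneg that by (simp add: sum_nonneg_eq_0_iff)
    then have f: "f j = 0" if "j < l" for j
      using that pos_q[OF that] by (force simp: v_def split: if_splits)
    have "m i = 0" "f i = 0" for i
      using that(1) m[of i] f[of i] unfolding T_def tuples_def x by (auto simp: not_less[symmetric])
    then show ?thesis by (simp add: x zero_prod_def fun_eq_iff)
  qed
  have "group_closure A \<subseteq> \<psi> ` T"
  proof (rule group_closure_minimal)
    have \<psi>_0: "\<psi> 0 = 0" using \<psi>_add[of 0 0] by simp
    have T_0: "0 \<in> T" by (auto simp: T_def tuples_def zero_prod_def)
    show "0 \<in> \<psi> ` T" using \<psi>_0 T_0 by force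
    have diff: "\<psi> (x - y) = \<psi> x - \<psi> y" for x y
      using \<psi>_add[of "x - y" y] by simp
    show "g - h \<in> \<psi> ` T" if "g \<in> \<psi> ` T" "h \<in> \<psi> ` T" for g h
      using that diff T_diff by (metis (no_types, lifting) image_iff)
    have P_image: "a \<in> \<psi> ` T" if a: "a \<in> P" for a
    proof (cases "- a = a")
      case False
      then obtain i where i: "i < k" "a = p i"
        using p a by (auto simp: bij_betw_def P1_def)
      let ?x = "(\<lambda>i'. if i' = i then 1 else 0, 0) :: (nat \<Rightarrow> int) \<times> (nat \<Rightarrow> bit)"
      have "\<psi> ?x = (\<Sum>i'<k. if i' = i then p i else 0)"
        unfolding \<psi>_def by (simp add: if_distrib[of "\<lambda>m. zscale m _"] cong: if_cong)
      then have "\<psi> ?x = a" using i by simp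
      moreover have "?x \<in> T" using i by (auto simp: T_def tuples_def)
      ultimately show ?thesis by (metis image_eqI)
    next
      case True
      then obtain j where j: "j < l" "a = q j"
        using q a by (auto simp: bij_betw_def P2_def)
      let ?x = "(0, \<lambda>j'. if j' = j then 1 else 0) :: (nat \<Rightarrow> int) \<times> (nat \<Rightarrow> bit)"
      have "\<psi> ?x = (\<Sum>j'<l. if j' = j then q j' else 0)"
      proof -
        have "(\<Sum>j'<l. if (if j' = j then 1 else 0) = (0::bit) then 0 else q j') =
          (\<Sum>j'<l. if j' = j then q j' else 0)"
          by (rule sum.cong) simp_all
        then show ?thesis by (simp add: \<psi>_def)
      qed
      then have "\<psi> ?x = a" using j by simp
      moreover have "?x \<in> T" using j by (auto simp: T_def tuples_def)
      ultimately show ?thesis by (metis image_eqI)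
    qed
    show "A \<subseteq> \<psi> ` T"
    proof
      fix a assume "a \<in> A"
      then consider "a \<in> P" | "- a \<in> P" using P(2) by blast
      then show "a \<in> \<psi> ` T"
      proof cases
        case 2
        then obtain x where x: "x \<in> T" "\<psi> x = - a" using P_image by (metis imageE)
        then have "\<psi> (0 - x) = a" using diff[of 0 x] \<psi>_0 by simp
        then show ?thesis using T_diff[OF T_0 x(1)] by blast
      qed (rule P_image)
    qed
  qed
  moreover have "inj_on \<psi> T"
    by (rule isometry_inj_on[where nrm = nrm and nrm' = nrm'])
      (use normed_ab_group_axioms T_diff \<psi>_add norm definite in auto)
  ultimately have bij: "bij_betw \<psi> T UNIV"
    using A_gen by (auto simp: bij_betw_def)
  have "isometric_isomorphism nrm T nrm' (inv_into T \<psi>)"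
    by (rule isometric_isomorphism_inv_into[OF bij]) (simp_all add: T_add \<psi>_add norm)
  then show ?thesis
    unfolding T_def nrm'_def using pos_p pos_q
    by (intro exI[of _ k] exI[of _ l] exI[of _ "\<lambda>i. nrm (p i)"] exI[of _ "\<lambda>j. nrm (q j)"] exI conjI) auto
qed

end

section \<open>Finite-dimensional normed spaces\<close>

lemma (in vector_space) independent_spans_Int:
  assumes "independent B" "a \<in> B" "b \<in> B" "a \<noteq> b" "x \<in> span {a}" "x \<in> span {b}"
  shows "x = 0"
proof -
  obtain c d where c: "x = scale c a" "x = scale d b"
    using assms(5,6) unfolding span_singleton by blast
  have "c = 0"
  proof (rule ccontr)
    assume "c \<noteq> 0"
    then have "a = scale (1 / c) (scale d b)" using c by (metis scale_scale scale_one nonzero_divide_eq_eq mult.commute)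
    moreover have "b \<in> B - {a}" using assms by blast
    ultimately have "a \<in> span (B - {a})"
      using span_scale span_base by metis
    then show False using assms(1,2) dependent_def by blast
  qed
  then show ?thesis using c by simp
qed

locale normed_vector_space = finite_dimensional_vector_space scale Basis + normed_ab_group nrm
  for scale :: "real \<Rightarrow> 'a::ab_group_add \<Rightarrow> 'a" (infixr "\<cdot>" 75) and Basis and nrm :: "'a \<Rightarrow> real" +
  assumes nrm_scale: "nrm (c \<cdot> x) = \<bar>c\<bar> * nrm x"
begin

lemma part_scale: "part x g \<Longrightarrow> part (c \<cdot> x) (c \<cdot> g)"
  unfolding part_def
  by (metis (no_types, lifting) distrib_left nrm_scale scale_right_diff_distrib)

text \<open>
  The parts of \<open>g\<close> generate a convex cone on which the norm is additive: if the decompositions of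
  \<open>g\<close> given by \<open>x\<close> and \<open>y\<close> are averaged, all the triangle inequalities involved must be equalities.
\<close>

lemma part_midpoint:
  assumes "part x g" "part y g"
  shows "part ((1/2) \<cdot> (x + y)) g" and "nrm (x + y) = nrm x + nrm y"
proof -
  have "g = (1/2) \<cdot> (g + g)"
    by (metis field_sum_of_halves scale_left_distrib scale_one scale_right_distrib)
  then have "g - (1/2) \<cdot> (x + y) = (1/2) \<cdot> ((g - x) + (g - y))"
    by (metis add_diff_add scale_right_diff_distrib)
  then have "nrm (g - (1/2) \<cdot> (x + y)) \<le> (nrm (g - x) + nrm (g - y)) / 2"
    using nrm_triangle[of "g - x" "g - y"] by (simp add: nrm_scale)
  moreover have "nrm ((1/2) \<cdot> (x + y)) = nrm (x + y) / 2"
    by (simp add: nrm_scale)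
  ultimately show "part ((1/2) \<cdot> (x + y)) g" "nrm (x + y) = nrm x + nrm y"
    using assms nrm_triangle[of x y] nrm_le_part[of g "(1/2) \<cdot> (x + y)"]
    unfolding part_def by argo+
qed

lemma part_shrink:
  assumes "part x g" "0 \<le> c" "c \<le> 1"
  shows "part (c \<cdot> x) g"
proof -
  have "g - c \<cdot> x = (g - x) + (1 - c) \<cdot> x"
    by (simp add: scale_left_diff_distrib)
  then have "nrm (g - c \<cdot> x) \<le> nrm (g - x) + nrm ((1 - c) \<cdot> x)"
    by (metis nrm_triangle)
  then have "nrm (g - c \<cdot> x) \<le> nrm (g - x) + (1 - c) * nrm x"
    using assms(3) by (simp add: nrm_scale)
  moreover have "nrm (c \<cdot> x) = c * nrm x" using assms(2) by (simp add: nrm_scale)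
  ultimately show ?thesis
    using assms(1) nrm_le_part[of g "c \<cdot> x"] unfolding part_def by (simp add: algebra_simps)
qed

text \<open>
  The span of a cone consists of differences of its elements; small multiples of these elements are
  parts of \<open>g\<close> themselves.
\<close>

lemma span_parts_imp_difference:
  assumes "w \<in> span {x. part x g}"
  shows "\<exists>\<epsilon>>0. \<epsilon> \<le> 1 \<and> (\<exists>p q. part p g \<and> part q g \<and> \<epsilon> \<cdot> w = p - q)"
  using assms
proof (induction rule: span_induct_alt)
  case base
  then show ?case using part_zero[of g] by (intro exI[of _ 1]) force
next
  case (step c x y)
  then obtain \<epsilon> p q where \<epsilon>: "0 < \<epsilon>" "\<epsilon> \<le> 1" and pq: "part p g" "part q g" "\<epsilon> \<cdot> y = p - q"
    by blast
  \<comment> \<open>Small enough for both \<open>\<delta> y\<close> and \<open>\<delta> c x\<close> to be differences of parts.\<close>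
  define \<delta> where "\<delta> = \<epsilon> / (1 + \<bar>c\<bar>)"
  have \<delta>: "0 < \<delta>" "\<delta> \<le> 1" "\<delta> \<le> \<epsilon>" "\<delta> * \<bar>c\<bar> \<le> 1"
  proof -
    have "\<delta> * (1 + \<bar>c\<bar>) = \<epsilon>" by (simp add: \<delta>_def)
    then have "\<delta> + \<delta> * \<bar>c\<bar> = \<epsilon>" by (simp add: distrib_left)
    moreover show pos: "0 < \<delta>" using \<epsilon>(1) by (simp add: \<delta>_def)
    moreover have "0 \<le> \<delta> * \<bar>c\<bar>" using pos by simp
    ultimately show "\<delta> \<le> 1" "\<delta> \<le> \<epsilon>" "\<delta> * \<bar>c\<bar> \<le> 1" using \<epsilon> by linarith+
  qed
  have x: "part x g" using step by simp
  define r where "r = \<delta> / \<epsilon>"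
  have r: "0 \<le> r" "r \<le> 1" using \<delta> \<epsilon> by (auto simp: r_def)
  have y: "\<delta> \<cdot> y = r \<cdot> p - r \<cdot> q"
  proof -
    have "\<delta> \<cdot> y = r \<cdot> (\<epsilon> \<cdot> y)" using \<epsilon>(1) by (simp add: r_def)
    then show ?thesis by (simp add: pq(3) scale_right_diff_distrib)
  qed
  define a where "a = (if 0 \<le> c then (\<delta> * \<bar>c\<bar>) \<cdot> x else 0)"
  define b where "b = (if 0 \<le> c then 0 else (\<delta> * \<bar>c\<bar>) \<cdot> x)"
  have ab: "part a g" "part b g" "\<delta> \<cdot> c \<cdot> x = a - b"
    using part_shrink[OF x, of "\<delta> * \<bar>c\<bar>"] \<delta> part_zero by (auto simp: a_def b_def)
  have "(\<delta> / 2) \<cdot> (c \<cdot> x + y) = (1/2) \<cdot> (a + r \<cdot> p) - (1/2) \<cdot> (b + r \<cdot> q)"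
  proof -
    have "(\<delta> / 2) \<cdot> (c \<cdot> x + y) = (1/2) \<cdot> (\<delta> \<cdot> c \<cdot> x + \<delta> \<cdot> y)"
      by (simp add: scale_right_distrib)
    then show ?thesis unfolding ab(3) y
      by (simp add: scale_right_diff_distrib scale_right_distrib)
  qed
  moreover have "part ((1/2) \<cdot> (a + r \<cdot> p)) g" "part ((1/2) \<cdot> (b + r \<cdot> q)) g"
    by (intro part_midpoint(1) ab(1,2) part_shrink[OF pq(1) r] part_shrink[OF pq(2) r])+
  ultimately show ?case
    using \<delta> by (intro exI[of _ "\<delta> / 2"]) auto
qed

lemma continuous_on_nrm_line: "continuous_on UNIV (\<lambda>t::real. nrm (a + t \<cdot> x))"
proof (rule continuous_on_subset[OF lipschitz_on_continuous_on])
  show "(nrm x)-lipschitz_on UNIV (\<lambda>t::real. nrm (a + t \<cdot> x))"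
  proof (rule lipschitz_onI)
    fix s t :: real
    have "nrm (a + t \<cdot> x) \<le> nrm (a + s \<cdot> x) + \<bar>s - t\<bar> * nrm x" for s t
    proof -
      have "a + t \<cdot> x = (a + s \<cdot> x) + (t - s) \<cdot> x"
        by (simp add: scale_left_diff_distrib)
      then have "nrm (a + t \<cdot> x) \<le> nrm (a + s \<cdot> x) + nrm ((t - s) \<cdot> x)"
        by (metis nrm_triangle)
      then show ?thesis by (simp add: nrm_scale abs_minus_commute)
    qed
    from this[of s t] this[of t s]
    show "dist (nrm (a + s \<cdot> x)) (nrm (a + t \<cdot> x)) \<le> nrm x * dist s t"
      by (simp add: dist_real_def abs_minus_commute mult.commute abs_le_iff algebra_simps)
  qed (rule nrm_nonneg)
qed simp

lemma maximal_multiple_part: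
  assumes "x \<noteq> 0"
  obtains t where "0 \<le> t" "part (t \<cdot> x) g" "\<And>s. part (s \<cdot> x) g \<Longrightarrow> s \<le> t"
proof -
  define T where "T = {t. part (t \<cdot> x) g}"
  have pos: "nrm x > 0" using assms nrm_nonneg[of x] nrm_eq_0_iff[of x] by linarith
  have "T = {t. nrm (0 + t \<cdot> x) + nrm (- g + t \<cdot> x) = nrm g}"
    unfolding T_def part_def using nrm_diff_commute by (auto simp: algebra_simps)
  then have "closed T"
    by (simp only:) (intro closed_Collect_eq continuous_on_add continuous_on_nrm_line continuous_on_const)
  moreover have "\<bar>t\<bar> \<le> nrm g / nrm x" if "t \<in> T" for t
    using that pos nrm_nonneg[of "g - t \<cdot> x"]
    by (simp add: T_def part_def nrm_scale pos_le_divide_eq)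
  then have "bounded T" by (intro boundedI[of T "nrm g / nrm x"]) simp
  ultimately have "compact T" by (simp add: compact_eq_bounded_closed)
  moreover have "0 \<in> T" by (simp add: T_def part_zero)
  ultimately obtain t where "t \<in> T" "\<And>s. s \<in> T \<Longrightarrow> s \<le> t"
    using compact_attains_sup[of T] by blast
  then show thesis using \<open>0 \<in> T\<close> that unfolding T_def by blast
qed

text \<open>
  The maximality of \<open>t\<close> says that no positive multiple of \<open>x\<close> is a part of the remainder
  \<open>z = g - t x\<close>. If \<open>x\<close> were in the span of the parts of \<open>z\<close>, then \<open>p = \<epsilon> x + q\<close> for parts \<open>p, q\<close>
  of \<open>z\<close>. The norm is additive on parts of \<open>g\<close>, so \<open>\<epsilon> x\<close> is a part of \<open>p\<close>, hence of \<open>z\<close>.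
\<close>

lemma not_in_span_parts_of_remainder:
  assumes x: "part x g" and t: "0 \<le> t" "part (t \<cdot> x) g" "\<And>s. part (s \<cdot> x) g \<Longrightarrow> s \<le> t"
  shows "x \<notin> span {y. part y (g - t \<cdot> x)}"
proof
  let ?z = "g - t \<cdot> x"
  assume "x \<in> span {y. part y ?z}"
  then obtain \<epsilon> p q where \<epsilon>: "0 < \<epsilon>" "\<epsilon> \<le> 1"
    and pq: "part p ?z" "part q ?z" "\<epsilon> \<cdot> x = p - q"
    using span_parts_imp_difference by blast
  have "part ?z g" using t(2) by (simp add: part_def)
  then have "part q g" using pq(2) part_trans by blast
  moreover have "part (\<epsilon> \<cdot> x) g" using part_shrink[OF x] \<epsilon> by simp
  ultimately have "nrm (\<epsilon> \<cdot> x + q) = nrm (\<epsilon> \<cdot> x) + nrm q" by (intro part_midpoint(2))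
  then have "part (\<epsilon> \<cdot> x) p" using pq(3) by (simp add: part_def)
  then have *: "part (\<epsilon> \<cdot> x) ?z" using pq(1) part_trans by blast
  have "part ((t + \<epsilon>) \<cdot> x) g"
  proof -
    have "g - (t + \<epsilon>) \<cdot> x = ?z - \<epsilon> \<cdot> x" by (simp add: scale_left_distrib)
    then show ?thesis
      using * t(1,2) \<epsilon>(1) unfolding part_def by (simp only: nrm_scale) (simp add: distrib_right)
  qed
  then show False using t(3) \<epsilon>(1) by fastforce
qed

text \<open>
  Up to scaling these are the extreme points of the unit ball, together with zero.
\<close>

definition extreme :: "'a \<Rightarrow> bool"
  where "extreme e \<longleftrightarrow> (\<forall>x. part x e \<longrightarrow> x \<in> span {e})"

lemma dim_parts_less:
  assumes x: "part x g" and t: "0 \<le> t" "part (t \<cdot> x) g" "\<And>s. part (s \<cdot> x) g \<Longrightarrow> s \<le> t"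
  shows "dim {y. part y (g - t \<cdot> x)} < dim {y. part y g}"
proof -
  have "part (g - t \<cdot> x) g" using t(2) by (simp add: part_def)
  then have "{y. part y (g - t \<cdot> x)} \<subseteq> {y. part y g}" using part_trans by blast
  then have "span {y. part y (g - t \<cdot> x)} \<subseteq> span {y. part y g}" by (rule span_mono)
  moreover have "x \<in> span {y. part y g}" using x by (simp add: span_base)
  ultimately have "span {y. part y (g - t \<cdot> x)} \<subset> span {y. part y g}"
    using not_in_span_parts_of_remainder[OF assms] by blast
  then show ?thesis by (rule dim_psubset)
qed

text \<open>
  By induction on the dimension of the span of the parts of \<open>g\<close>. Removing the largest multiple of a
  part \<open>x\<close> gives \<open>z\<close> of lower dimension, but \<open>x\<close> itself may have full dimension. The largest
  multiple of \<open>z\<close> is therefore removed from \<open>g\<close> in turn: this remainder has lower dimension as well,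
  and \<open>g\<close> is a combination of it and \<open>z\<close>.
\<close>

lemma extreme_vectors_span: "span {e. extreme e} = UNIV"
proof -
  have "g \<in> span {e. extreme e}" for g
  proof (induction "dim {y. part y g}" arbitrary: g rule: less_induct)
    case less
    show ?case
    proof (cases "extreme g")
      case False
      then obtain x where x: "part x g" "x \<notin> span {g}" unfolding extreme_def by blast
      then have "x \<noteq> 0" using span_zero by blast
      then obtain t where t: "0 \<le> t" "part (t \<cdot> x) g" "\<And>s. part (s \<cdot> x) g \<Longrightarrow> s \<le> t"
        using maximal_multiple_part by blast
      define z where "z = g - t \<cdot> x"
      have "z \<noteq> 0"
      proof
        assume "z = 0"
        then have g: "g = t \<cdot> x" by (simp add: z_def)
        have "t \<noteq> 0" using g x(1) \<open>x \<noteq> 0\<close> part_of_zero by auto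
        then have "x = (1 / t) \<cdot> g" by (simp add: g)
        then show False using x(2) span_scale[OF span_base[of g "{g}"]] by auto
      qed
      have z: "part z g" using t(2) by (simp add: z_def part_def)
      obtain s where s: "0 \<le> s" "part (s \<cdot> z) g" "\<And>r. part (r \<cdot> z) g \<Longrightarrow> r \<le> s"
        using maximal_multiple_part[OF \<open>z \<noteq> 0\<close>] by blast
      have "z \<in> span {e. extreme e}"
        unfolding z_def by (rule less) (rule dim_parts_less[OF x(1) t])
      moreover have "g - s \<cdot> z \<in> span {e. extreme e}"
        by (rule less) (rule dim_parts_less[OF z s])
      ultimately have "(g - s \<cdot> z) + s \<cdot> z \<in> span {e. extreme e}"
        by (intro span_add span_scale)
      then show ?thesis by simp
    qed (simp add: span_base)
  qed
  then show ?thesis by blast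
qed

lemma part_of_multiple_of_extreme:
  assumes "extreme e" "part x (c \<cdot> e)"
  shows "x \<in> span {e}"
proof (cases "c = 0")
  case True
  then show ?thesis using assms part_of_zero span_zero by auto
next
  case False
  then have "part ((1 / c) \<cdot> x) e" using part_scale[OF assms(2), of "1 / c"] by simp
  then have "c \<cdot> (1 / c) \<cdot> x \<in> span {e}"
    using assms(1) span_scale unfolding extreme_def by blast
  then show ?thesis using False by simp
qed

end

locale nonbranching_normed_space =
  normed_vector_space scale Basis nrm + nonbranching_group nrm
  for scale :: "real \<Rightarrow> 'a::ab_group_add \<Rightarrow> 'a" (infixr "\<cdot>" 75) and Basis and nrm :: "'a \<Rightarrow> real"
begin

theorem normed_space_classification:
  "\<exists>n \<phi>. ((UNIV :: 'a set) \<noteq> {0} \<longrightarrow> n \<ge> 1) \<and>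
    Vector_Spaces.linear scale (\<lambda>c x i. c * x i) \<phi> \<and>
    isometric_isomorphism nrm (tuples n) (l1_norm n) \<phi>"
proof -
  obtain B where B: "B \<subseteq> {e. extreme e}" "independent B" "{e. extreme e} \<subseteq> span B"
    using maximal_independent_subset[of "{e. extreme e}"] by blast
  have B_span: "span B = UNIV"
    using span_minimal[OF B(3) subspace_span] extreme_vectors_span by auto
  have "finite B" using B(2) by (rule finiteI_independent)
  define n where "n = card B"
  obtain b where b: "bij_betw b {..<n} B"
    using ex_bij_betw_nat_finite[OF \<open>finite B\<close>] by (auto simp: n_def atLeast0LessThan)
  have b_mem: "b i \<in> B" if "i < n" for i using b that by (auto simp: bij_betw_def)
  have pos: "nrm (b i) > 0" if "i < n" for i
  proof -
    have "b i \<noteq> 0" using B(2) b_mem[OF that] dependent_zero by metis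
    then show ?thesis using nrm_nonneg[of "b i"] nrm_eq_0_iff[of "b i"] by linarith
  qed
  define T where "T = (tuples n :: (nat \<Rightarrow> real) set)"
  define \<psi> where "\<psi> = (\<lambda>x. \<Sum>i<n. (x i / nrm (b i)) \<cdot> b i)"
  have \<psi>_add: "\<psi> (x + y) = \<psi> x + \<psi> y" for x y
    by (simp add: \<psi>_def add_divide_distrib scale_left_distrib sum.distrib)
  have \<psi>_scale: "\<psi> (\<lambda>i. c * x i) = c \<cdot> \<psi> x" for c x
    by (simp add: \<psi>_def scale_sum_right)
  have norm: "nrm (\<psi> x) = l1_norm n x" for x
  proof -
    have "nrm (\<psi> x) = (\<Sum>i<n. nrm ((x i / nrm (b i)) \<cdot> b i))"
      unfolding \<psi>_def
    proof (rule nrm_sum_no_opposite_parts)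
      fix i j y
      assume ij: "i \<in> {..<n}" "j \<in> {..<n}" "i \<noteq> j"
        and y: "part y ((x i / nrm (b i)) \<cdot> b i)" "part (- y) ((x j / nrm (b j)) \<cdot> b j)"
      have mem: "b i \<in> B" "b j \<in> B" "b i \<noteq> b j"
        using ij b by (auto simp: bij_betw_def inj_on_def)
      then have "extreme (b i)" "extreme (b j)" using B(1) by auto
      then have "y \<in> span {b i}" "- y \<in> span {b j}"
        using part_of_multiple_of_extreme y by blast+
      moreover from this(2) have "y \<in> span {b j}" using span_neg[of "- y" "{b j}"] by simp
      ultimately show "y = 0" using independent_spans_Int[OF B(2) mem] by blast
    qed simp
    also have "\<dots> = l1_norm n x"
      unfolding l1_norm_def
    proof (rule sum.cong)
      fix i assume "i \<in> {..<n}"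
      then show "nrm ((x i / nrm (b i)) \<cdot> b i) = \<bar>x i\<bar>"
        using pos[of i] by (simp add: nrm_scale)
    qed simp
    finally show ?thesis .
  qed
  have definite: "x = 0" if "x \<in> T" "l1_norm n x = 0" for x
  proof -
    have "x i = 0" for i
      using that by (cases "i < n") (auto simp: T_def tuples_def l1_norm_def sum_nonneg_eq_0_iff)
    then show ?thesis by (simp add: fun_eq_iff)
  qed
  have T_diff: "x - y \<in> T" and T_add: "x + y \<in> T" and T_scale: "(\<lambda>i. c * x i) \<in> T"
    if "x \<in> T" "y \<in> T" for x y c
    using that unfolding T_def tuples_def by simp_all
  have surj: "v \<in> \<psi> ` T" for v
  proof -
    obtain u where u: "v = (\<Sum>e\<in>B. u e \<cdot> e)"
      using B_span span_finite[OF \<open>finite B\<close>] by blast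
    define x where "x i = (if i < n then u (b i) * nrm (b i) else 0)" for i
    have "\<psi> x = (\<Sum>i<n. u (b i) \<cdot> b i)"
      unfolding \<psi>_def
    proof (rule sum.cong)
      fix i assume "i \<in> {..<n}"
      then show "(x i / nrm (b i)) \<cdot> b i = u (b i) \<cdot> b i" using pos[of i] by (simp add: x_def)
    qed simp
    also have "\<dots> = v" unfolding u by (rule sum.reindex_bij_betw[OF b])
    finally have "\<psi> x = v" .
    moreover have "x \<in> T" by (simp add: T_def tuples_def x_def)
    ultimately show ?thesis by blast
  qed
  have inj: "inj_on \<psi> T"
    by (rule isometry_inj_on[where nrm = nrm and nrm' = "l1_norm n"])
      (use normed_ab_group_axioms T_diff \<psi>_add norm definite in auto)
  then have bij: "bij_betw \<psi> T UNIV" using surj by (auto simp: bij_betw_def)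
  define \<phi> where "\<phi> = inv_into T \<psi>"
  have iso: "isometric_isomorphism nrm T (l1_norm n) \<phi>"
    unfolding \<phi>_def
    by (rule isometric_isomorphism_inv_into[OF bij]) (simp_all add: T_add \<psi>_add norm)
  have \<phi>_mem: "\<phi> g \<in> T" and \<psi>_\<phi>: "\<psi> (\<phi> g) = g" for g
    unfolding \<phi>_def by (rule inv_into_into[OF surj], rule f_inv_into_f[OF surj])
  have "\<phi> (c \<cdot> g) = (\<lambda>i. c * \<phi> g i)" for c g
  proof (rule inj_onD[OF inj])
    show "\<psi> (\<phi> (c \<cdot> g)) = \<psi> (\<lambda>i. c * \<phi> g i)" by (simp add: \<psi>_scale \<psi>_\<phi>)
  qed (use \<phi>_mem T_scale in auto)
  moreover have "vector_space (\<lambda>(c::real) (x::nat \<Rightarrow> real) i. c * x i)"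
    by standard (simp_all add: fun_eq_iff algebra_simps)
  ultimately have "Vector_Spaces.linear scale (\<lambda>c x i. c * x i) \<phi>"
    using iso vector_space_axioms by (simp add: Vector_Spaces.linear_iff isometric_isomorphism_def)
  moreover have "n \<ge> 1" if "(UNIV :: 'a set) \<noteq> {0}"
  proof (rule ccontr)
    assume "\<not> n \<ge> 1"
    then have "B = {}" using \<open>finite B\<close> card_0_eq[of B] unfolding n_def by linarith
    then show False using B_span that by simp
  qed
  ultimately show ?thesis
    using iso unfolding T_def by (intro exI[of _ n] exI[of _ \<phi>] conjI impI) auto
qed

end

section \<open>The classification\<close>

theorem theorem1p8:
  fixes nrm :: "'a::ab_group_add \<Rightarrow> real"
  assumes "normed_ab_group nrm"
    and "has_nonbranching_optimal_transport_plans nrm"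
  shows "(finitely_generated_group TYPE('a) \<and> complete_nrm nrm \<longrightarrow>
      (\<exists>k l \<mu> \<nu> \<phi>. (\<forall>i<k. \<mu> i > 0) \<and> (\<forall>j<l. \<nu> j > 0) \<and>
        isometric_isomorphism nrm (tuples k \<times> tuples l) (weighted_l1_norm k l \<mu> \<nu>) \<phi>)) \<and>
    (\<forall>smul :: real \<Rightarrow> 'a \<Rightarrow> 'a. fin_dim_normed_space smul nrm \<longrightarrow>
      (\<exists>n \<phi>. ((UNIV :: 'a set) \<noteq> {0} \<longrightarrow> n \<ge> 1) \<and>
        Vector_Spaces.linear smul (\<lambda>c x i. c * x i) \<phi> \<and>
        isometric_isomorphism nrm (tuples n) (l1_norm n) \<phi>))"
proof -
  interpret nonbranching_group nrm
    using assms unfolding has_nonbranching_optimal_transport_plans_def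
    by (intro nonbranching_group.intro nonbranching_group_axioms.intro) blast+
  have "\<exists>n \<phi>. ((UNIV :: 'a set) \<noteq> {0} \<longrightarrow> n \<ge> 1) \<and>
      Vector_Spaces.linear smul (\<lambda>c x i. c * x i) \<phi> \<and>
      isometric_isomorphism nrm (tuples n) (l1_norm n) \<phi>"
    if space: "fin_dim_normed_space smul nrm" for smul :: "real \<Rightarrow> 'a \<Rightarrow> 'a"
  proof -
    obtain Basis where "finite_dimensional_vector_space smul Basis"
      and "\<And>c x. nrm (smul c x) = \<bar>c\<bar> * nrm x"
      using space unfolding fin_dim_normed_space_def by blast
    then interpret nonbranching_normed_space smul Basis nrm
      by (intro nonbranching_normed_space.intro normed_vector_space.intro
          normed_vector_space_axioms.intro nonbranching_group_axioms normed_ab_group_axioms)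
    show ?thesis by (rule normed_space_classification)
  qed
  then show ?thesis using finitely_generated_classification by blast
qed

end
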